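(* Consider the system $\partial_t\Phi+\partial_x\boldsymbol f(\Phi)=\boldsymbol 0$, $f_i(\Phi)=\phi_iv_i(\Phi)$, $i=1,\dots,N$, with velocity functions $v_i(\Phi)$ chosen such that there exists a function $w=w(\phi)$ satisfying properties (W1)--(W5) of the context (with associated $\boldsymbol\kappa$ and $\psi$). Consider the Harten--Lax--van Leer (HLL) scheme defined by the marching formula $$\Phi_j^{n+1}=\Phi_j^n-\lambda_n\bigl(\boldsymbol{\mathcal F}^{\mathrm{HLL}}_{j+1/2}-\boldsymbol{\mathcal F}^{\mathrm{HLL}}_{j-1/2}\bigr),$$ where $$\boldsymbol{\mathcal F}^{\mathrm{HLL}}_{j+1/2}=\frac{S^+_{\mathrm R,j+1/2}\boldsymbol f(\Phi_j^n)-S^-_{\mathrm L,j+1/2}\boldsymbol f(\Phi_{j+1}^n)+S^-_{\mathrm L,j+1/2}S^+_{\mathrm R,j+1/2}(\Phi_{j+1}^n-\Phi_j^n)}{S^+_{\mathrm R,j+1/2}-S^-_{\mathrm L,j+1/2}},$$ $$S_{\mathrm L,j+1/2}=\min_{0\le s\le1}\tilde M_1\bigl(s\Phi_{j+1}^n+(1-s)\Phi_j^n\bigr),\qquad S_{\mathrm R,j+1/2}=\max_{0\le s\le1}M_2\bigl(s\Phi_{j+1}^n+(1-s)\Phi_j^n\bigr),$$ with $a^-=\min(a,0)$, $a^+=\max(a,0)$, $\tilde M_1(\Phi)=\psi(\phi)\,\boldsymbol\kappa^{\mathrm T}\Phi$ and $M_2(\Phi)$ the upper eigenvalue bound of the model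 under study (see context). If the CFL condition $$\alpha\lambda_n\le\tfrac12,\qquad \alpha:=\max_j\bigl\{|S_{\mathrm L,j+1/2}|,|S_{\mathrm R,j+1/2}|\bigr\},$$ is in effect, then the HLL scheme satisfies the invariant region preservation property: for all $n=0,\dots,N_T-1$, if $\Phi_j^n\in\mathcal D_{\phi_{\max}}$ for all $j$, then $\Phi_j^{n+1}\in\mathcal D_{\phi_{\max}}$ for all $j$.
   Context: For $\Phi=(\phi_1,\dots,\phi_N)^{\mathrm T}$ write $\phi:=\phi_1+\dots+\phi_N$; $\phi_{\max}>0$ is a given maximum value and $$\mathcal D_{\phi_{\max}}:=\{\Phi\in\mathbb R^N:\ \phi_1\ge0,\dots,\phi_N\ge0,\ \phi\le\phi_{\max}\}.$$ The system is posed on $x\in[0,L]$, $t>0$, with $\boldsymbol f=(f_1,\dots,f_N)^{\mathrm T}$, and is assumed hyperbolic on $\mathcal D_{\phi_{\max}}$; $\lambda_1(\Phi)\ge\dots\ge\lambda_N(\Phi)$ are the eigenvalues of the Jacobian matrix of $\boldsymbol f$ at $\Phi\in\mathcal D_{\phi_{\max}}$. Properties of $w$: (W1) $w=w(\phi)$ is piecewise differentiable and $\sum_{i=1}^N\phi_iv_i(\Phi)=w(\phi)\,\boldsymbol\kappa^{\mathrm T}\Phi$, where $\boldsymbol\kappa=(\kappa_1,\dots,\kappa_N)^{\mathrm T}$ with parameters $\kappa_1\ge\dots\ge\kappa_N>0$. (W2) $w(\phi)\ge0$ for all $\phi\in[0,\phi_{\max}]$. (W3) $w(\phi_{\max})=0$.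 (W4) $w'$ is nondecreasing, i.e. $w'(\phi)\le w'(\tilde\phi)$ if $0\le\phi\le\tilde\phi\le\phi_{\max}$. (W5) There exists a piecewise continuous function $\psi(\phi)$ such that $\psi(\phi)\,\boldsymbol\kappa^{\mathrm T}\Phi\le\lambda_N(\Phi)$ and $w'(\phi)\ge\psi(\phi)$ for all $\Phi\in\mathcal D_{\phi_{\max}}$. Wave speed bounds. $S_{\mathrm L,j+1/2}$ and $S_{\mathrm R,j+1/2}$ play the role of lower and upper bounds for the eigenvalues at the interface $x_{j+1/2}$. The function $M_2$ is the upper eigenvalue bound belonging to the model under study, and is specified for two models (for both of which $S^-_{\mathrm L,j+1/2}<S^+_{\mathrm R,j+1/2}$ for all $j$, so that the HLL flux is well defined): - Multiclass Lighthill--Whitham--Richards (MCLWR) traffic model: $v_i=\beta_iv(\phi)$, $\beta_1>\dots>\beta_N>0$, $v>0$ on $[0,\phi_{\max})$, $v(\phi_{\max})=0$, $v'\le0$, $v'$ nondecreasing; here $M_2(\Phi)=\beta_1v(\phi)$, $w=v$, $\boldsymbol\kappa=(\beta_1,\dots,\beta_N)^{\mathrm T}$, $\psi=v'$. - Masliyah--Lockett--Bassoon (MLB) polydisperse sedimentation model: $v_i(\Phi)=C(1-\phi)V(\phi)(\delta_i-\boldsymbol\delta^{\mathrm T}\Phi)$, $\boldsymbol\delta=(\delta_1,\dots,\delta_N)^{\mathrm T}$, $\delta_i=D_i^2/D_1^2$ with particle diameters $D_1>\dots>D_N$, $C$ a constant (proportional to the solid--fluid density difference), $V>0$ on $[0,\phi_{\max})$,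 $V(\phi_{\max})=0$, $V'\le0$; here $M_2(\Phi)=v_1(\Phi)$, $w(\phi)=C(1-\phi)^2V(\phi)$, $\boldsymbol\kappa=\boldsymbol\delta$, $\psi(\phi)=C[(1-\phi)V'(\phi)-2V(\phi)]$. Discretization. $[0,L]$ is divided into $M$ cells of width $\Delta x=L/M$, indexed by $j=0,\dots,M-1$, cell $j$ having interfaces $x_{j-1/2}$ and $x_{j+1/2}$; $\Delta t_n$, $n=0,\dots,N_T-1$, are the time steps and $\lambda_n:=\Delta t_n/\Delta x$. $\Phi_j^n$ is the numerical solution in cell $j$ at time level $n$. Boundary conditions are either periodic (all indices $j$ understood modulo $M$, so the fluxes at interfaces $-1/2$ and $M-1/2$ coincide) or zero-flux (the fluxes at interfaces $-1/2$ and $M-1/2$ are set to $\boldsymbol 0$).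
   Formalization: The system is assumed to be one of the two models for which M_2 is specified (MCLWR or MLB), in addition to (W1)-(W5); for a general system M_2 is not defined, and with an arbitrary upper eigenvalue bound the claim fails. *)

theory Defs
  imports "HOL-Analysis.Analysis"
begin

text \<open>
  Vectors in \<open>\<real>\<^sup>N\<close> are elements of \<open>real ^ 'n\<close> with a finite, linearly ordered index type
  \<open>'n\<close>; the linear order carries the numbering of the species, so the indices \<open>1\<close> and \<open>N\<close> are
  the least and the greatest element of \<open>'n\<close>.
\<close>

type_synonym 'n state = "(real, 'n) vec"
type_synonym 'n matrix = "((real, 'n) vec, 'n) vec"

definition first_species :: "'n::{finite,linorder}" where
  "first_species = Min UNIV"

definition last_species :: "'n::{finite,linorder}" where
  "last_species = Max UNIV"

definition total_conc :: "real ^ 'n \<Rightarrow> real" where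
  "total_conc \<Phi> = (\<Sum>i\<in>UNIV. \<Phi> $ i)"

definition phase_space :: "real \<Rightarrow> (real ^ 'n) set" where
  "phase_space \<phi>max = {\<Phi>. (\<forall>i. 0 \<le> \<Phi> $ i) \<and> total_conc \<Phi> \<le> \<phi>max}"

definition flux :: "(real ^ 'n \<Rightarrow> real ^ 'n) \<Rightarrow> real ^ 'n \<Rightarrow> real ^ 'n" where
  "flux v \<Phi> = (\<chi> i. \<Phi> $ i * v \<Phi> $ i)"


subsection \<open>Piecewise notions\<close>

text \<open>
  \<open>f'\<close> is the derivative of \<open>f\<close> on \<open>{a..b}\<close> (one-sided at the end points) wherever it exists. At the
  finitely many break points the value \<open>f' x\<close> is not prescribed here; it is only subject to the
  inequalities that are imposed on \<open>f'\<close> on the whole interval.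
\<close>

definition has_piecewise_derivative_on ::
    "(real \<Rightarrow> real) \<Rightarrow> (real \<Rightarrow> real) \<Rightarrow> real \<Rightarrow> real \<Rightarrow> bool" where
  "has_piecewise_derivative_on f f' a b \<longleftrightarrow>
     f piecewise_differentiable_on {a..b} \<and>
     (\<forall>x\<in>{a..b}. f differentiable (at x within {a..b}) \<longrightarrow>
        (f has_real_derivative f' x) (at x within {a..b}))"

definition piecewise_continuous_on :: "(real \<Rightarrow> real) \<Rightarrow> real \<Rightarrow> real \<Rightarrow> bool" where
  "piecewise_continuous_on f a b \<longleftrightarrow>
     finite {x\<in>{a..b}. \<not> continuous (at x within {a..b}) f} \<and>
     (\<forall>x\<in>{a..<b}. \<exists>l. (f \<longlongrightarrow> l) (at_right x)) \<and>
     (\<forall>x\<in>{a<..b}. \<exists>l. (f \<longlongrightarrow> l) (at_left x))"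


subsection \<open>Hyperbolicity\<close>

text \<open>
  \<open>l\<close> lists the zeros of the characteristic polynomial of \<open>A\<close> with multiplicity in
  non-increasing order; existence of such an \<open>l\<close> says that all eigenvalues of \<open>A\<close> are real.
\<close>

definition sorted_eigenvalues :: "'n::{finite,linorder} matrix \<Rightarrow> 'n state \<Rightarrow> bool" where
  "sorted_eigenvalues A l \<longleftrightarrow>
     (\<forall>x. det (mat x - A) = (\<Prod>i\<in>UNIV. x - l $ i)) \<and>
     (\<forall>i j. i \<le> j \<longrightarrow> l $ j \<le> l $ i)"

text \<open>
  Hyperbolicity is meant as real eigenvalues, without diagonalizability: on the boundary of the
  phase space the Jacobian can have Jordan blocks (in the traffic model already for two classes).
  The derivative is taken within the phase space. Since \<open>f\<close> is only piecewise smooth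
  in the applications, the condition concerns the states at which the Jacobian exists.
\<close>

definition hyperbolic_with_eigenvalues ::
    "('n::{finite,linorder} state \<Rightarrow> 'n state) \<Rightarrow> 'n state set \<Rightarrow> ('n state \<Rightarrow> 'n state) \<Rightarrow> bool"
  where
  "hyperbolic_with_eigenvalues f D eig \<longleftrightarrow>
     (\<forall>\<Phi>\<in>D. \<forall>J. (f has_derivative (\<lambda>h. J *v h)) (at \<Phi> within D) \<longrightarrow> sorted_eigenvalues J (eig \<Phi>))"


subsection \<open>The two models\<close>

definition MCLWR_model ::
    "real \<Rightarrow> ('n::{finite,linorder} state \<Rightarrow> 'n state) \<Rightarrow> (real \<Rightarrow> real) \<Rightarrow> 'n state \<Rightarrow> (real \<Rightarrow> real)
       \<Rightarrow> ('n state \<Rightarrow> real) \<Rightarrow> bool" where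
  "MCLWR_model \<phi>max vel w \<kappa> \<psi> M2 \<longleftrightarrow>
     (\<exists>(\<beta> :: 'n state) (v :: real \<Rightarrow> real) (v' :: real \<Rightarrow> real).
        (\<forall>i j. i < j \<longrightarrow> \<beta> $ j < \<beta> $ i) \<and> (\<forall>i. 0 < \<beta> $ i) \<and>
        has_piecewise_derivative_on v v' 0 \<phi>max \<and>
        (\<forall>x\<in>{0..<\<phi>max}. 0 < v x) \<and> v \<phi>max = 0 \<and>
        (\<forall>x\<in>{0..\<phi>max}. v' x \<le> 0) \<and> mono_on {0..\<phi>max} v' \<and>
        (\<forall>\<Phi>\<in>phase_space \<phi>max. \<forall>i. vel \<Phi> $ i = \<beta> $ i * v (total_conc \<Phi>)) \<and>
        (\<forall>\<Phi>\<in>phase_space \<phi>max. M2 \<Phi> = \<beta> $ first_species * v (total_conc \<Phi>)) \<and>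
        (\<forall>x\<in>{0..\<phi>max}. w x = v x) \<and> \<kappa> = \<beta> \<and>
        (\<forall>x\<in>{0..\<phi>max}. \<psi> x = v' x))"

definition MLB_model ::
    "real \<Rightarrow> ('n::{finite,linorder} state \<Rightarrow> 'n state) \<Rightarrow> (real \<Rightarrow> real) \<Rightarrow> 'n state \<Rightarrow> (real \<Rightarrow> real)
       \<Rightarrow> ('n state \<Rightarrow> real) \<Rightarrow> bool" where
  "MLB_model \<phi>max vel w \<kappa> \<psi> M2 \<longleftrightarrow>
     (\<exists>(d :: 'n state) (\<delta> :: 'n state) (C :: real) (V :: real \<Rightarrow> real) (V' :: real \<Rightarrow> real).
        (\<forall>i j. i < j \<longrightarrow> d $ j < d $ i) \<and> (\<forall>i. 0 < d $ i) \<and>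
        (\<forall>i. \<delta> $ i = (d $ i)\<^sup>2 / (d $ first_species)\<^sup>2) \<and>
        has_piecewise_derivative_on V V' 0 \<phi>max \<and>
        (\<forall>x\<in>{0..<\<phi>max}. 0 < V x) \<and> V \<phi>max = 0 \<and>
        (\<forall>x\<in>{0..\<phi>max}. V' x \<le> 0) \<and>
        (\<forall>\<Phi>\<in>phase_space \<phi>max. \<forall>i.
           vel \<Phi> $ i = C * (1 - total_conc \<Phi>) * V (total_conc \<Phi>) * (\<delta> $ i - \<delta> \<bullet> \<Phi>)) \<and>
        (\<forall>\<Phi>\<in>phase_space \<phi>max. M2 \<Phi> = vel \<Phi> $ first_species) \<and>
        (\<forall>x\<in>{0..\<phi>max}. w x = C * (1 - x)\<^sup>2 * V x) \<and> \<kappa> = \<delta> \<and>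
        (\<forall>x\<in>{0..\<phi>max}. \<psi> x = C * ((1 - x) * V' x - 2 * V x)))"


subsection \<open>The HLL scheme\<close>

definition M1_tilde :: "(real \<Rightarrow> real) \<Rightarrow> real ^ 'n \<Rightarrow> real ^ 'n \<Rightarrow> real" where
  "M1_tilde \<psi> \<kappa> \<Phi> = \<psi> (total_conc \<Phi>) * (\<kappa> \<bullet> \<Phi>)"

text \<open>
  Minimum and maximum over the segment are written as \<open>INF\<close> and \<open>SUP\<close>. They agree with the minimum and
  maximum whenever these are attained, and they still make sense if \<open>\<psi>\<close> has a jump on the segment.
\<close>

definition speed_L :: "(real ^ 'n \<Rightarrow> real) \<Rightarrow> real ^ 'n \<Rightarrow> real ^ 'n \<Rightarrow> real" where
  "speed_L M1 \<Phi>l \<Phi>r = (INF s\<in>{0..1::real}. M1 (s *\<^sub>R \<Phi>r + (1 - s) *\<^sub>R \<Phi>l))"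

definition speed_R :: "(real ^ 'n \<Rightarrow> real) \<Rightarrow> real ^ 'n \<Rightarrow> real ^ 'n \<Rightarrow> real" where
  "speed_R M2 \<Phi>l \<Phi>r = (SUP s\<in>{0..1::real}. M2 (s *\<^sub>R \<Phi>r + (1 - s) *\<^sub>R \<Phi>l))"

text \<open>If both truncated speeds vanish, the convention \<open>x / 0 = 0\<close> makes the flux \<open>0\<close>.\<close>

definition HLL_flux ::
    "(real ^ 'n \<Rightarrow> real ^ 'n) \<Rightarrow> (real ^ 'n \<Rightarrow> real) \<Rightarrow> (real ^ 'n \<Rightarrow> real) \<Rightarrow>
       real ^ 'n \<Rightarrow> real ^ 'n \<Rightarrow> real ^ 'n" where
  "HLL_flux f M1 M2 \<Phi>l \<Phi>r =
     (let sL = min (speed_L M1 \<Phi>l \<Phi>r) 0; sR = max (speed_R M2 \<Phi>l \<Phi>r) 0 in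
        (sR *\<^sub>R f \<Phi>l - sL *\<^sub>R f \<Phi>r + (sL * sR) *\<^sub>R (\<Phi>r - \<Phi>l)) /\<^sub>R (sR - sL))"

datatype boundary = Periodic | Zero_Flux

text \<open>
  A grid function \<open>u :: int \<Rightarrow> real ^ 'n\<close> only matters at the cells \<open>0, \<dots>, M - 1\<close>. The integer \<open>j\<close> also
  names the interface \<open>x\<^bsub>j+1/2\<^esub>\<close>, so \<open>-1\<close> and \<open>M - 1\<close> are the two ends of the domain.
\<close>

definition left_state :: "nat \<Rightarrow> (int \<Rightarrow> 'a) \<Rightarrow> int \<Rightarrow> 'a" where
  "left_state M u j = u (j mod int M)"

definition right_state :: "nat \<Rightarrow> (int \<Rightarrow> 'a) \<Rightarrow> int \<Rightarrow> 'a" where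
  "right_state M u j = u ((j + 1) mod int M)"

fun active_interfaces :: "boundary \<Rightarrow> nat \<Rightarrow> int set" where
  "active_interfaces Periodic M = {-1..int M - 1}"
| "active_interfaces Zero_Flux M = {0..int M - 2}"

definition numerical_flux ::
    "boundary \<Rightarrow> nat \<Rightarrow> (real ^ 'n \<Rightarrow> real ^ 'n \<Rightarrow> real ^ 'n) \<Rightarrow> (int \<Rightarrow> real ^ 'n) \<Rightarrow> int \<Rightarrow> real ^ 'n"
  where
  "numerical_flux bc M F u j =
     (if j \<in> active_interfaces bc M then F (left_state M u j) (right_state M u j) else 0)"

text \<open>
  The maximum of the absolute speeds over all interfaces. Inserting \<open>0\<close> only matters for one cell with
  zero-flux conditions, where there is no interface with two neighbouring cells.
\<close>

definition max_speed ::
    "boundary \<Rightarrow> nat \<Rightarrow> (real ^ 'n \<Rightarrow> real) \<Rightarrow> (real ^ 'n \<Rightarrow> real) \<Rightarrow> (int \<Rightarrow> real ^ 'n) \<Rightarrow> real" where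
  "max_speed bc M M1 M2 u =
     Max (insert 0 (\<Union>j\<in>active_interfaces bc M.
       {\<bar>speed_L M1 (left_state M u j) (right_state M u j)\<bar>,
        \<bar>speed_R M2 (left_state M u j) (right_state M u j)\<bar>}))"

end

theory Submission
  imports Defs
begin

text \<open>
  If a nonnegative scalar has left and right values \<open>x, y\<close> and physical fluxes \<open>p, q\<close> with
  \<open>s\<^sub>L x \<le> p \<le> s\<^sub>R x\<close> and \<open>s\<^sub>L y \<le> q \<le> s\<^sub>R y\<close>, its HLL flux lies between \<open>s\<^sub>L y\<close> and \<open>s\<^sub>R x\<close>. Under the
  CFL condition a cell therefore loses at most half of its content through each interface, and
  the scalar stays nonnegative. This applies to every species, since \<open>M\<^sub>1 \<le> v\<^sub>i \<le> M\<^sub>2\<close> in both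
  models. It also applies to the vacancy \<open>\<phi>max - \<phi>\<close>, viewed as an additional species with
  flux \<open>- w(\<phi>) \<kappa>\<^sup>T\<Phi>\<close>: convexity of \<open>w\<close> and \<open>w(\<phi>max) = 0\<close> give
  \<open>w(\<phi>) \<le> - w'(\<phi>) (\<phi>max - \<phi>) \<le> - \<psi>(\<phi>) (\<phi>max - \<phi>)\<close>.
\<close>

section \<open>Linearity of the total concentration; convexity and boundedness of the phase
  space\<close>

lemma total_conc_add: "total_conc (X + Y) = total_conc X + total_conc Y"
  by (simp add: total_conc_def sum.distrib)

lemma total_conc_diff: "total_conc (X - Y) = total_conc X - total_conc Y"
  by (simp add: total_conc_def sum_subtractf)

lemma total_conc_scaleR: "total_conc (c *\<^sub>R X) = c * total_conc X"
  by (simp add: total_conc_def sum_distrib_left)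

lemma phase_spaceD:
  assumes "X \<in> phase_space m"
  shows "0 \<le> X $ i" "total_conc X \<in> {0..m}"
  using assms by (auto simp: phase_space_def total_conc_def intro: sum_nonneg)

lemma phase_space_segment:
  assumes "X \<in> phase_space m" "Y \<in> phase_space m" "s \<in> {0..1}"
  shows "s *\<^sub>R Y + (1 - s) *\<^sub>R X \<in> phase_space m"
proof -
  have "s * total_conc Y + (1 - s) * total_conc X \<le> s * m + (1 - s) * m"
    using assms by (intro add_mono mult_left_mono) (auto simp: phase_space_def)
  then show ?thesis
    using assms
    by (auto simp: phase_space_def total_conc_add total_conc_scaleR simp flip: distrib_right)
qed

lemma norm_phase_space_le:
  assumes "X \<in> phase_space m"
  shows "norm X \<le> m"
proof -
  have "norm X \<le> (\<Sum>i\<in>UNIV. \<bar>X $ i\<bar>)"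
    by (rule norm_le_l1_cart)
  also have "\<dots> = total_conc X"
    using phase_spaceD(1)[OF assms] by (simp add: total_conc_def)
  finally show ?thesis
    using phase_spaceD(2)[OF assms] by simp
qed

lemma abs_inner_phase_space_le:
  assumes "X \<in> phase_space m"
  shows "\<bar>k \<bullet> X\<bar> \<le> norm k * m"
  using Cauchy_Schwarz_ineq2[of k X] norm_phase_space_le[OF assms]
  by (meson mult_left_mono norm_ge_zero order_trans)

lemma inner_phase_space_nonneg:
  assumes "X \<in> phase_space m" "\<forall>i. 0 < k $ i"
  shows "0 \<le> k \<bullet> X"
  using phase_spaceD(1)[OF assms(1)] assms(2)
  by (auto simp: inner_vec_def less_imp_le intro!: sum_nonneg mult_nonneg_nonneg)

section \<open>Calculus of piecewise continuous and piecewise differentiable functions\<close>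

text \<open>One-sided limits bound \<open>f\<close> on a punctured neighbourhood of each point, and
  bisection glues these local bounds together. Boundedness of \<open>\<psi>\<close> is what makes
  the infimum in \<open>speed_L\<close> a genuine lower bound.\<close>

lemma piecewise_continuous_on_bounded:
  assumes "piecewise_continuous_on f a b"
  obtains B where "\<And>x. x \<in> {a..b} \<Longrightarrow> \<bar>f x\<bar> \<le> B"
proof -
  \<comment> \<open>The induction varies both end points while the domain must stay fixed. The short
    intervals around a point may also protrude from \<open>{a..b}\<close>, hence the intersection
    with \<open>D\<close>.\<close>
  define D where "D = {a..b}"
  have "bounded (f ` ({a..b} \<inter> D))" if "a \<le> b"
    using that
  proof (induction rule: Bolzano)
    case (trans c d e)
    have "{c..e} = {c..d} \<union> {d..e}"
      using trans by auto
    then show ?case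
      using trans by (simp only: Int_Un_distrib2 image_Un bounded_Un)
  next
    case (local x)
    have right: "\<exists>d>x. \<exists>B. \<forall>y\<in>{x<..<d} \<inter> D. \<bar>f y\<bar> \<le> B"
    proof (cases "x < b")
      case True
      then obtain l where "(f \<longlongrightarrow> l) (at_right x)"
        using assms local unfolding piecewise_continuous_on_def
        by (meson atLeastLessThan_iff greaterThanAtMost_iff)
      from tendstoD[OF this, of 1] obtain d where "d > x" "\<forall>y>x. y < d \<longrightarrow> dist (f y) l < 1"
        by (auto simp: eventually_at_right_field)
      then show ?thesis
        by (intro exI[of _ d] conjI exI[of _ "\<bar>l\<bar> + 1"]) (force simp: dist_real_def)+
    next
      case False
      then show ?thesis
        by (intro exI[of _ "x + 1"]) (auto simp: D_def)
    qed
    have left: "\<exists>d<x. \<exists>B. \<forall>y\<in>{d<..<x} \<inter> D. \<bar>f y\<bar> \<le> B"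
    proof (cases "a < x")
      case True
      then obtain l where "(f \<longlongrightarrow> l) (at_left x)"
        using assms local unfolding piecewise_continuous_on_def
        by (meson atLeastLessThan_iff greaterThanAtMost_iff)
      from tendstoD[OF this, of 1] obtain d where "d < x" "\<forall>y>d. y < x \<longrightarrow> dist (f y) l < 1"
        by (auto simp: eventually_at_left_field)
      then show ?thesis
        by (intro exI[of _ d] conjI exI[of _ "\<bar>l\<bar> + 1"]) (force simp: dist_real_def)+
    next
      case False
      then show ?thesis
        by (intro exI[of _ "x - 1"]) (auto simp: D_def)
    qed
    obtain d1 B1 d2 B2 where d: "x < d1" "d2 < x"
      and B: "\<forall>y\<in>{x<..<d1} \<inter> D. \<bar>f y\<bar> \<le> B1" "\<forall>y\<in>{d2<..<x} \<inter> D. \<bar>f y\<bar> \<le> B2"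
      using right left by blast
    show ?case
    proof (intro exI[of _ "min (d1 - x) (x - d2)"] conjI allI impI)
      fix p q assume pq: "p \<le> x \<and> x \<le> q \<and> q - p < min (d1 - x) (x - d2)"
      \<comment> \<open>The one-sided limits say nothing about the value at \<open>x\<close> itself,
        so \<open>\<bar>f x\<bar>\<close> enters the bound separately.\<close>
      have "\<bar>f y\<bar> \<le> max \<bar>f x\<bar> (max B1 B2)" if "y \<in> {p..q} \<inter> D" for y
      proof -
        consider "y = x" | "y \<in> {x<..<d1} \<inter> D" | "y \<in> {d2<..<x} \<inter> D"
          using \<open>y \<in> {p..q} \<inter> D\<close> pq by force
        then show ?thesis
          proof cases
            case 1
            then show ?thesis by simp
          next
            case 2
            then show ?thesis using B(1) by (force simp: le_max_iff_disj)
          next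
            case 3
            then show ?thesis using B(2) by (force simp: le_max_iff_disj)
          qed
      qed
      then show "bounded (f ` ({p..q} \<inter> D))"
        unfolding bounded_iff by (intro exI[of _ "max \<bar>f x\<bar> (max B1 B2)"]) auto
    qed (use d in auto)
  qed
  then have "\<exists>B. \<forall>x\<in>{a..b}. \<bar>f x\<bar> \<le> B"
    by (cases "a \<le> b") (auto simp: bounded_iff D_def)
  then show thesis
    using that by metis
qed

text \<open>The increment of \<open>f\<close> is the integral of \<open>f'\<close>, since
  \<open>f\<close> is continuous and only finitely many points are exceptional; monotonicity then
  compares \<open>f'\<close> with its values at the two ends. This is the tangent inequality of a
  convex function. It holds even if \<open>x\<close> or \<open>y\<close> is a break point, where
  \<open>f'\<close> is constrained by monotonicity alone.\<close>

lemma mono_piecewise_derivative_tangent: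
  assumes deriv: "has_piecewise_derivative_on f f' a b" and mono: "mono_on {a..b} f'"
    and xy: "x \<in> {a..b}" "y \<in> {a..b}" "x \<le> y"
  shows "f' x * (y - x) \<le> f y - f x" "f y - f x \<le> f' y * (y - x)"
proof -
  obtain S where S: "finite S" "\<And>t. t \<in> {a..b} - S \<Longrightarrow> f differentiable (at t within {a..b})"
    and cont: "continuous_on {a..b} f"
    using deriv by (auto simp: has_piecewise_derivative_on_def piecewise_differentiable_on_def)
  have sub: "{x..y} \<subseteq> {a..b}"
    using xy by auto
  have "(f' has_integral (f y - f x)) {x..y}"
  proof (rule fundamental_theorem_of_calculus_interior_strong[OF S(1) xy(3)])
    fix t assume t: "t \<in> {x<..<y} - S"
    then have "(f has_real_derivative f' t) (at t within {a..b})"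
      using deriv S(2)[of t] sub by (auto simp: has_piecewise_derivative_on_def)
    moreover have "at t within {a..b} = at t"
      using t xy by (intro at_within_Icc_at) auto
    ultimately show "(f has_vector_derivative f' t) (at t)"
      by (simp add: has_real_derivative_iff_has_vector_derivative)
  qed (use cont sub continuous_on_subset in blast)
  moreover have "((\<lambda>_. f' x) has_integral f' x * (y - x)) {x..y}"
    "((\<lambda>_. f' y) has_integral f' y * (y - x)) {x..y}"
    using has_integral_const_real[of "f' x" x y] has_integral_const_real[of "f' y" x y] xy(3)
    by (simp_all add: mult.commute)
  moreover have "f' x \<le> f' t" "f' t \<le> f' y" if "t \<in> {x..y}" for t
    using that xy sub by (auto intro!: mono_onD[OF mono])
  ultimately show "f' x * (y - x) \<le> f y - f x" "f y - f x \<le> f' y * (y - x)"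
    by (meson has_integral_le)+
qed

lemma has_piecewise_derivative_on_bounded:
  assumes "has_piecewise_derivative_on f f' a b"
  obtains B where "\<And>x. x \<in> {a..b} \<Longrightarrow> \<bar>f x\<bar> \<le> B"
proof -
  have "continuous_on {a..b} f"
    using assms by (auto simp: has_piecewise_derivative_on_def piecewise_differentiable_on_def)
  then have "bounded (f ` {a..b})"
    by (intro compact_imp_bounded compact_continuous_image) auto
  then show thesis
    using that unfolding bounded_iff real_norm_def by (metis imageI)
qed

section \<open>Bounds for the HLL flux\<close>

text \<open>After multiplication by \<open>sR - sL\<close>, the gap \<open>F - sL * y\<close>
  becomes \<open>sR * (p - sL * x) - sL * (q - sL * y)\<close>, and \<open>sR * x - F\<close>
  becomes \<open>sR * (sR * x - p) + sL * (q - sR * y)\<close>. All four terms are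
  nonnegative.\<close>

lemma HLL_bounds:
  fixes sL sR p q x y :: real
  assumes s: "sL \<le> 0" "0 \<le> sR"
    and p: "sL * x \<le> p" "p \<le> sR * x" and q: "sL * y \<le> q" "q \<le> sR * y"
  defines "F \<equiv> (sR * p - sL * q + sL * sR * (y - x)) / (sR - sL)"
  shows "sL * y \<le> F" "F \<le> sR * x"
proof -
  have "sL * y \<le> F \<and> F \<le> sR * x"
  proof (cases "sR - sL = 0")
    \<comment> \<open>Both speeds are zero here; \<open>F\<close> is 0 by the convention
      \<open>x / 0 = 0\<close>, and so are both bounds.\<close>
    case True
    then have "sL = 0" "sR = 0"
      using s by auto
    then show ?thesis
      by (simp add: F_def)
  next
    case False
    then have pos: "0 < sR - sL"
      using s by simp
    have "sL * (q - sL * y) \<le> 0" "0 \<le> sR * (p - sL * x)"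
      "0 \<le> sL * (q - sR * y)" "sR * (p - sR * x) \<le> 0"
      using s p q by (auto intro: mult_nonpos_nonneg mult_nonneg_nonneg mult_nonpos_nonpos
          mult_nonneg_nonpos)
    then show ?thesis
      using pos unfolding F_def by (simp add: pos_le_divide_eq pos_divide_le_eq algebra_simps)
  qed
  then show "sL * y \<le> F" "F \<le> sR * x"
    by auto
qed

text \<open>\<open>HLL_bounds\<close> is applied once to a species, with physical flux
  \<open>X $ i * vel X $ i\<close>, and once to the vacancy \<open>m - total_conc X\<close>, with
  physical flux \<open>- total_conc (flux vel X)\<close>.\<close>

lemma HLL_flux_bounds:
  fixes vel :: "real ^ 'n \<Rightarrow> real ^ 'n"
  assumes X: "X \<in> phase_space m" and Y: "Y \<in> phase_space m"
    and vel: "\<And>Z i. Z \<in> phase_space m \<Longrightarrow> M1 Z \<le> vel Z $ i \<and> vel Z $ i \<le> M2 Z"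
    and vacancy: "\<And>Z. Z \<in> phase_space m \<Longrightarrow> 0 \<le> total_conc (flux vel Z) \<and>
                    total_conc (flux vel Z) \<le> - M1 Z * (m - total_conc Z)"
    and M1: "\<And>Z. Z \<in> phase_space m \<Longrightarrow> K1 \<le> M1 Z"
    and M2: "\<And>Z. Z \<in> phase_space m \<Longrightarrow> M2 Z \<le> K2"
  defines "sL \<equiv> min (speed_L M1 X Y) 0" and "sR \<equiv> max (speed_R M2 X Y) 0"
    and "F \<equiv> HLL_flux (flux vel) M1 M2 X Y"
  shows "sL * Y $ i \<le> F $ i" "F $ i \<le> sR * X $ i"
    and "- sR * (m - total_conc X) \<le> total_conc F" "total_conc F \<le> - sL * (m - total_conc Y)"
proof -
  let ?seg = "\<lambda>s. s *\<^sub>R Y + (1 - s) *\<^sub>R X"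
  note seg = phase_space_segment[OF X Y]
  have s: "sL \<le> 0" "0 \<le> sR"
    by (auto simp: sL_def sR_def)
  \<comment> \<open>A real infimum is a lower bound only for a set that is bounded below.
    \<open>K1\<close> supplies this here, and \<open>K2\<close> does the same for the
    supremum.\<close>
  have "bdd_below ((\<lambda>s. M1 (?seg s)) ` {0..1})"
    by (rule bdd_belowI2[where m = K1]) (rule M1[OF seg])
  then have "speed_L M1 X Y \<le> M1 (?seg s)" if "s \<in> {0..1}" for s
    unfolding speed_L_def using that by (rule cINF_lower)
  \<comment> \<open>The parameters 0 and 1 give the end points \<open>X\<close> and \<open>Y\<close>
    of the segment, the only states at which the speeds are compared.\<close>
  from this[of 0] this[of 1] have sL: "sL \<le> M1 X" "sL \<le> M1 Y"
    by (auto simp: sL_def)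
  have "bdd_above ((\<lambda>s. M2 (?seg s)) ` {0..1})"
    by (rule bdd_aboveI2[where M = K2]) (rule M2[OF seg])
  then have "M2 (?seg s) \<le> speed_R M2 X Y" if "s \<in> {0..1}" for s
    unfolding speed_R_def using that by (intro cSUP_upper)
  from this[of 0] this[of 1] have sR: "M2 X \<le> sR" "M2 Y \<le> sR"
    by (auto simp: sR_def)
  have F: "F = (sR *\<^sub>R flux vel X - sL *\<^sub>R flux vel Y + (sL * sR) *\<^sub>R (Y - X)) /\<^sub>R (sR - sL)"
    by (simp only: F_def HLL_flux_def sL_def sR_def Let_def)
  have species: "sL * Z $ i \<le> Z $ i * vel Z $ i" "Z $ i * vel Z $ i \<le> sR * Z $ i"
    if "Z \<in> {X, Y}" for Z
  proof -
    have "Z \<in> phase_space m" "sL \<le> vel Z $ i" "vel Z $ i \<le> sR"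
      using that X Y sL sR vel[of X i] vel[of Y i] by auto
    then show "sL * Z $ i \<le> Z $ i * vel Z $ i" "Z $ i * vel Z $ i \<le> sR * Z $ i"
      using phase_spaceD(1)[of Z m i] by (simp_all add: mult.commute[of _ "Z $ i"] mult_left_mono)
  qed
  have Fi: "F $ i = (sR * (X $ i * vel X $ i) - sL * (Y $ i * vel Y $ i)
      + sL * sR * (Y $ i - X $ i)) / (sR - sL)"
    by (simp add: F flux_def divide_inverse mult.commute)
  show "sL * Y $ i \<le> F $ i" "F $ i \<le> sR * X $ i"
    unfolding Fi using s species by (intro HLL_bounds; simp)+
  have vac: "sL * (m - total_conc Z) \<le> - total_conc (flux vel Z)"
    "- total_conc (flux vel Z) \<le> sR * (m - total_conc Z)" if "Z \<in> {X, Y}" for Z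
  proof -
    have Z: "Z \<in> phase_space m" "sL \<le> M1 Z"
      using that X Y sL by auto
    have "sL * (m - total_conc Z) \<le> M1 Z * (m - total_conc Z)"
      using Z phase_spaceD(2)[OF Z(1)] by (intro mult_right_mono) auto
    then show "sL * (m - total_conc Z) \<le> - total_conc (flux vel Z)"
      using vacancy[OF Z(1)] by simp
    \<comment> \<open>The vacancy flux is nonpositive, so any nonnegative speed bounds it from
      above.\<close>
    have "0 \<le> sR * (m - total_conc Z)"
      using s phase_spaceD(2)[OF Z(1)] by simp
    then show "- total_conc (flux vel Z) \<le> sR * (m - total_conc Z)"
      using vacancy[OF Z(1)] by simp
  qed
  \<comment> \<open>By linearity of \<open>total_conc\<close>, and because \<open>m\<close> cancels
    in the difference, minus the total HLL flux is the scalar HLL flux of the vacancy.\<close>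
  have tot: "- total_conc F = (sR * (- total_conc (flux vel X)) - sL * (- total_conc (flux vel Y))
      + sL * sR * ((m - total_conc Y) - (m - total_conc X))) / (sR - sL)"
    by (simp add: F total_conc_scaleR total_conc_add total_conc_diff divide_inverse algebra_simps)
  have "sL * (m - total_conc Y) \<le> - total_conc F" "- total_conc F \<le> sR * (m - total_conc X)"
    unfolding tot using s vac by (intro HLL_bounds; simp)+
  then show "- sR * (m - total_conc X) \<le> total_conc F" "total_conc F \<le> - sL * (m - total_conc Y)"
    by simp_all
qed

section \<open>Velocity bounds in the two models\<close>

lemma first_species_le: "first_species \<le> i"
  by (simp add: first_species_def)

text \<open>Zero separates the lower bound from the velocities: \<open>v' \<le> 0\<close> makes
  \<open>M1_tilde\<close> nonpositive, while \<open>v\<close> is nonnegative. The first species is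
  the fastest because \<open>\<kappa>\<close> is ordered. The constant \<open>K\<close> comes from
  continuity of \<open>v\<close> and keeps the supremum in \<open>speed_R\<close> finite.\<close>

lemma MCLWR_speed_bounds:
  fixes vel :: "'n::{finite,linorder} state \<Rightarrow> 'n state"
  assumes model: "MCLWR_model m vel w \<kappa> \<psi> M2" and \<kappa>: "\<forall>i j. i \<le> j \<longrightarrow> \<kappa> $ j \<le> \<kappa> $ i"
  obtains K where "\<And>(X :: 'n state) i. X \<in> phase_space m \<Longrightarrow>
    M1_tilde \<psi> \<kappa> X \<le> vel X $ i \<and> vel X $ i \<le> M2 X \<and> M2 X \<le> K"
proof -
  obtain v v' where \<kappa>_pos: "\<forall>i. 0 < \<kappa> $ i"
    and v: "has_piecewise_derivative_on v v' 0 m" "\<forall>x\<in>{0..<m}. 0 < v x" "v m = 0"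
    and v': "\<forall>x\<in>{0..m}. v' x \<le> 0"
    and vel: "\<forall>X\<in>phase_space m. \<forall>i. vel X $ i = \<kappa> $ i * v (total_conc X)"
    and M2: "\<forall>X\<in>phase_space m. M2 X = \<kappa> $ first_species * v (total_conc X)"
    and \<psi>: "\<forall>x\<in>{0..m}. \<psi> x = v' x"
    using model unfolding MCLWR_model_def by blast
  obtain B where B: "\<And>x. x \<in> {0..m} \<Longrightarrow> \<bar>v x\<bar> \<le> B"
    using has_piecewise_derivative_on_bounded[OF v(1)] by blast
  show thesis
  proof (rule that[of "\<kappa> $ first_species * B"], intro conjI)
    fix X :: "'n state" and i assume X: "X \<in> phase_space m"
    note x = phase_spaceD(2)[OF X]
    have v0: "0 \<le> v (total_conc X)"
      using v x by (cases "total_conc X = m") (auto intro: less_imp_le)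
    have "M1_tilde \<psi> \<kappa> X \<le> 0"
      using v' \<psi> x inner_phase_space_nonneg[OF X \<kappa>_pos]
      by (auto simp: M1_tilde_def intro: mult_nonpos_nonneg)
    moreover have "0 \<le> vel X $ i"
      using vel X v0 \<kappa>_pos by (simp add: less_imp_le)
    ultimately show "M1_tilde \<psi> \<kappa> X \<le> vel X $ i"
      by simp
    show "vel X $ i \<le> M2 X"
      using vel M2 X v0 \<kappa> first_species_le[of i] by (simp add: mult_right_mono)
    show "M2 X \<le> \<kappa> $ first_species * B"
      using M2 X B[OF x] \<kappa>_pos by (simp add: less_imp_le mult_left_mono)
  qed
qed

text \<open>
  For \<open>C > 0\<close> and \<open>m > 1\<close> the convex function \<open>w\<close> would vanish at \<open>1\<close> and \<open>m\<close> and be positive in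
  between.
\<close>

lemma MLB_hindered_settling_nonneg:
  assumes m: "0 < m"
    and w: "has_piecewise_derivative_on w w' 0 m" "mono_on {0..m} w'" "\<forall>x\<in>{0..m}. 0 \<le> w x"
    and w_eq: "\<forall>x\<in>{0..m}. w x = C * (1 - x)\<^sup>2 * V x"
    and V: "\<forall>x\<in>{0..<m}. 0 < V x" "V m = 0"
  shows "C = 0 \<or> 0 < C \<and> m \<le> 1"
proof -
  \<comment> \<open>The model does not prescribe the sign of \<open>C\<close>; nonnegativity of
    \<open>w\<close> at 0 determines it.\<close>
  have "w 0 = C * V 0" "0 \<le> w 0" "0 < V 0"
    using bspec[OF w_eq, of 0] bspec[OF w(3), of 0] bspec[OF V(1), of 0] m by auto
  then have "0 \<le> C"
    by (simp add: zero_le_mult_iff)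
  moreover have "m \<le> 1" if "0 < C"
  proof (rule ccontr)
    assume "\<not> m \<le> 1"
    then have m1: "1 < m"
      by simp
    define x where "x = (1 + m) / 2"
    have x: "1 < x" "x < m" "x \<in> {0..m}" "1 \<in> {0..m}" "m \<in> {0..m}"
      using m1 by (auto simp: x_def)
    have "w 1 = 0" "w m = 0"
      using w_eq x V(2) by auto
    moreover have "0 < w x"
      using w_eq x V(1) \<open>0 < C\<close> by auto
    moreover have "w' x * (m - x) \<le> w m - w x"
      using mono_piecewise_derivative_tangent(1)[OF w(1,2) x(3,5)] x by simp
    moreover have "w x - w 1 \<le> w' x * (x - 1)"
      using mono_piecewise_derivative_tangent(2)[OF w(1,2) x(4,3)] x by simp
    ultimately have "w' x * (m - x) < 0" "0 < w' x * (x - 1)"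
      by auto
    then show False
      using x by (simp add: mult_less_0_iff zero_less_mult_iff)
  qed
  ultimately show ?thesis
    by force
qed

text \<open>Velocities can be negative here, but with \<open>h = C * (1 - x) * V x\<close> they are
  at least \<open>- h * (\<kappa> \<bullet> X)\<close>, and \<open>\<psi> x \<le> - h\<close>. The
  hypotheses on \<open>w\<close> provide the sign of \<open>C\<close> and, for positive
  \<open>C\<close>, the bound \<open>m \<le> 1\<close>, which together give \<open>h\<close> its
  sign.\<close>

lemma MLB_speed_bounds:
  fixes vel :: "'n::{finite,linorder} state \<Rightarrow> 'n state"
  assumes model: "MLB_model m vel w \<kappa> \<psi> M2" and m: "0 < m"
    and \<kappa>: "\<forall>i j. i \<le> j \<longrightarrow> \<kappa> $ j \<le> \<kappa> $ i" "\<forall>i. 0 < \<kappa> $ i"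
    and w: "has_piecewise_derivative_on w w' 0 m" "mono_on {0..m} w'" "\<forall>x\<in>{0..m}. 0 \<le> w x"
  obtains K where "\<And>(X :: 'n state) i. X \<in> phase_space m \<Longrightarrow>
    M1_tilde \<psi> \<kappa> X \<le> vel X $ i \<and> vel X $ i \<le> M2 X \<and> M2 X \<le> K"
proof -
  obtain C V V' where V: "has_piecewise_derivative_on V V' 0 m" "\<forall>x\<in>{0..<m}. 0 < V x" "V m = 0"
    and V': "\<forall>x\<in>{0..m}. V' x \<le> 0"
    and vel: "\<forall>X\<in>phase_space m. \<forall>i.
           vel X $ i = C * (1 - total_conc X) * V (total_conc X) * (\<kappa> $ i - \<kappa> \<bullet> X)"
    and M2: "\<forall>X\<in>phase_space m. M2 X = vel X $ first_species"
    and w_eq: "\<forall>x\<in>{0..m}. w x = C * (1 - x)\<^sup>2 * V x"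
    and \<psi>: "\<forall>x\<in>{0..m}. \<psi> x = C * ((1 - x) * V' x - 2 * V x)"
    using model unfolding MLB_model_def by blast
  have C: "C = 0 \<or> 0 < C \<and> m \<le> 1"
    by (rule MLB_hindered_settling_nonneg[OF m w w_eq V(2,3)])
  obtain B where B: "\<And>x. x \<in> {0..m} \<Longrightarrow> \<bar>V x\<bar> \<le> B"
    using has_piecewise_derivative_on_bounded[OF V(1)] by blast
  show thesis
  proof (rule that[of "C * B * \<kappa> $ first_species"])
    fix X :: "'n state" and i assume X: "X \<in> phase_space m"
    define x where "x = total_conc X"
    have x: "x \<in> {0..m}"
      using phase_spaceD(2)[OF X] by (simp add: x_def)
    have k0: "0 \<le> \<kappa> \<bullet> X"
      by (rule inner_phase_space_nonneg[OF X \<kappa>(2)])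
    have V0: "0 \<le> V x"
      using V x by (cases "x = m") (auto intro: less_imp_le)
    show "M1_tilde \<psi> \<kappa> X \<le> vel X $ i \<and> vel X $ i \<le> M2 X \<and> M2 X \<le> C * B * \<kappa> $ first_species"
      using C
    proof
      \<comment> \<open>In this degenerate case \<open>M1_tilde\<close>, the velocities,
        \<open>M2\<close> and the proposed bound are all zero.\<close>
      assume "C = 0"
      then show ?thesis
        using vel M2 X \<psi> x by (simp add: M1_tilde_def x_def)
    next
      assume C: "0 < C \<and> m \<le> 1"
      define h where "h = C * (1 - x) * V x"
      have h0: "0 \<le> h"
        using C x V0 by (simp add: h_def)
      have hB: "h \<le> C * B"
      proof -
        have "(1 - x) * V x \<le> 1 * B"
          using C x V0 B[OF x] by (intro mult_mono) auto
        then show ?thesis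
          using C by (simp add: h_def mult.assoc)
      qed
      have veli: "vel X $ i = h * (\<kappa> $ i - \<kappa> \<bullet> X)" for i
        using vel X by (simp add: h_def x_def)
      \<comment> \<open>Indeed \<open>\<psi> x + h = C * ((1 - x) * V' x - V x - x * V x)\<close>,
        where no term in the bracket is positive because \<open>x \<le> 1\<close>.\<close>
      have "\<psi> x \<le> - h"
      proof -
        have "(1 - x) * V' x \<le> 0"
          using C x V' by (intro mult_nonneg_nonpos) auto
        moreover have "0 \<le> x * V x"
          using x V0 by simp
        ultimately have "(1 - x) * V' x - 2 * V x \<le> - ((1 - x) * V x)"
          using V0 by (simp add: algebra_simps)
        then have "C * ((1 - x) * V' x - 2 * V x) \<le> C * - ((1 - x) * V x)"
          using C by (intro mult_left_mono) auto
        then show ?thesis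
          using \<psi> x by (simp add: h_def mult.assoc)
      qed
      then have "M1_tilde \<psi> \<kappa> X \<le> - h * (\<kappa> \<bullet> X)"
        using k0 by (auto simp: M1_tilde_def x_def[symmetric] dest: mult_right_mono)
      also have "\<dots> \<le> vel X $ i"
        using h0 \<kappa>(2) by (simp add: veli right_diff_distrib less_imp_le)
      finally have "M1_tilde \<psi> \<kappa> X \<le> vel X $ i" .
      moreover have "vel X $ i \<le> M2 X"
        using M2 X h0 \<kappa>(1) first_species_le[of i] by (simp add: veli mult_left_mono)
      moreover have "M2 X \<le> C * B * \<kappa> $ first_species"
      proof -
        have "M2 X \<le> h * \<kappa> $ first_species"
          using M2 X h0 k0 by (simp add: veli mult_left_mono)
        also have "\<dots> \<le> C * B * \<kappa> $ first_species"
          using hB \<kappa>(2) by (intro mult_right_mono) (auto intro: less_imp_le)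
        finally show ?thesis .
      qed
      ultimately show ?thesis
        by simp
    qed
  qed
qed

section \<open>The CFL condition and preservation of the invariant region\<close>

lemma finite_active_interfaces: "finite (active_interfaces bc M)"
  by (cases bc) auto

lemma max_speed_ge:
  assumes "j \<in> active_interfaces bc M"
  shows "\<bar>speed_L M1 (left_state M u j) (right_state M u j)\<bar> \<le> max_speed bc M M1 M2 u"
    and "\<bar>speed_R M2 (left_state M u j) (right_state M u j)\<bar> \<le> max_speed bc M M1 M2 u"
  unfolding max_speed_def using assms finite_active_interfaces[of bc M]
  by (auto intro!: Max_ge)

theorem theorem2:
  fixes \<phi>max L :: real
    and vel :: "'n::{finite,linorder} state \<Rightarrow> 'n state"
    and eig :: "'n state \<Rightarrow> 'n state"
    and w w' \<psi> :: "real \<Rightarrow> real"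
    and \<kappa> :: "'n state"
    and M2 :: "'n state \<Rightarrow> real"
    and bc :: boundary
    and M NT :: nat
    and \<Delta>x :: real
    and \<Delta>t :: "nat \<Rightarrow> real"
    and \<Phi> :: "nat \<Rightarrow> int \<Rightarrow> 'n state"
  assumes phimax: "0 < \<phi>max"
    and hyperbolic: "hyperbolic_with_eigenvalues (flux vel) (phase_space \<phi>max) eig"
    and W1_deriv: "has_piecewise_derivative_on w w' 0 \<phi>max"
    and W1_sum: "\<forall>X\<in>phase_space \<phi>max. (\<Sum>i\<in>UNIV. X $ i * vel X $ i) = w (total_conc X) * (\<kappa> \<bullet> X)"
    and W1_kappa: "\<forall>i j. i \<le> j \<longrightarrow> \<kappa> $ j \<le> \<kappa> $ i" "\<forall>i. 0 < \<kappa> $ i"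
    and W2: "\<forall>x\<in>{0..\<phi>max}. 0 \<le> w x"
    and W3: "w \<phi>max = 0"
    and W4: "mono_on {0..\<phi>max} w'"
    and W5_cont: "piecewise_continuous_on \<psi> 0 \<phi>max"
    and W5_bounds: "\<forall>X\<in>phase_space \<phi>max.
          \<psi> (total_conc X) * (\<kappa> \<bullet> X) \<le> eig X $ last_species \<and> \<psi> (total_conc X) \<le> w' (total_conc X)"
    and model: "MCLWR_model \<phi>max vel w \<kappa> \<psi> M2 \<or> MLB_model \<phi>max vel w \<kappa> \<psi> M2"
    and grid: "0 < L" "0 < M" "\<Delta>x = L / real M"
    and time_steps: "\<forall>n<NT. 0 < \<Delta>t n"
    and scheme: "\<forall>n<NT. \<forall>j\<in>{0..<int M}.
          \<Phi> (Suc n) j = \<Phi> n j - (\<Delta>t n / \<Delta>x) *\<^sub>R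
            (numerical_flux bc M (HLL_flux (flux vel) (M1_tilde \<psi> \<kappa>) M2) (\<Phi> n) j
             - numerical_flux bc M (HLL_flux (flux vel) (M1_tilde \<psi> \<kappa>) M2) (\<Phi> n) (j - 1))"
    and CFL: "\<forall>n<NT. max_speed bc M (M1_tilde \<psi> \<kappa>) M2 (\<Phi> n) * (\<Delta>t n / \<Delta>x) \<le> 1 / 2"
  shows "\<forall>n<NT. (\<forall>j\<in>{0..<int M}. \<Phi> n j \<in> phase_space \<phi>max) \<longrightarrow>
                 (\<forall>j\<in>{0..<int M}. \<Phi> (Suc n) j \<in> phase_space \<phi>max)"
proof (intro allI impI ballI)
  fix n j
  assume n: "n < NT" and inv: "\<forall>j\<in>{0..<int M}. \<Phi> n j \<in> phase_space \<phi>max"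
    and j: "j \<in> {0..<int M}"
  let ?M1 = "M1_tilde \<psi> \<kappa>"
  let ?F = "numerical_flux bc M (HLL_flux (flux vel) ?M1 M2) (\<Phi> n)"
  define r where "r = \<Delta>t n / \<Delta>x"
  have r: "0 \<le> r"
    using grid time_steps n by (simp add: r_def less_imp_le)
  \<comment> \<open>From here on both models are treated alike, through the chain
    \<open>M1_tilde \<le> vel \<le> M2 \<le> K2\<close>.\<close>
  obtain K2 where vel: "M1_tilde \<psi> \<kappa> X \<le> vel X $ i \<and> vel X $ i \<le> M2 X" and M2: "M2 X \<le> K2"
    if "X \<in> phase_space \<phi>max" for X i
    using model MCLWR_speed_bounds[OF _ W1_kappa(1)]
      MLB_speed_bounds[OF _ phimax W1_kappa W1_deriv W4 W2] by metis
  obtain B where B: "\<And>x. x \<in> {0..\<phi>max} \<Longrightarrow> \<bar>\<psi> x\<bar> \<le> B"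
    using piecewise_continuous_on_bounded[OF W5_cont] by blast
  \<comment> \<open>\<open>B\<close> bounds \<open>\<psi>\<close>, and Cauchy-Schwarz bounds the
    inner product; this lower bound serves as \<open>K1\<close>.\<close>
  have M1: "- (B * (norm \<kappa> * \<phi>max)) \<le> ?M1 X" if "X \<in> phase_space \<phi>max" for X
  proof -
    have "\<bar>?M1 X\<bar> \<le> B * (norm \<kappa> * \<phi>max)"
      unfolding M1_tilde_def abs_mult
      using B[OF phase_spaceD(2)[OF that]] abs_inner_phase_space_le[OF that]
      by (intro mult_mono) auto
    then show ?thesis
      by linarith
  qed
  have vacancy: "0 \<le> total_conc (flux vel X) \<and>
      total_conc (flux vel X) \<le> - ?M1 X * (\<phi>max - total_conc X)" if X: "X \<in> phase_space \<phi>max" for X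
  proof -
    define x where "x = total_conc X"
    have x: "x \<in> {0..\<phi>max}"
      using phase_spaceD(2)[OF X] by (simp add: x_def)
    have k0: "0 \<le> \<kappa> \<bullet> X"
      by (rule inner_phase_space_nonneg[OF X W1_kappa(2)])
    have tot: "total_conc (flux vel X) = w x * (\<kappa> \<bullet> X)"
      using W1_sum X by (simp add: total_conc_def flux_def x_def)
    have "\<psi> x * (\<phi>max - x) \<le> w' x * (\<phi>max - x)"
      using W5_bounds X x by (intro mult_right_mono) (auto simp: x_def)
    also have "\<dots> \<le> - w x"
      using mono_piecewise_derivative_tangent(1)[OF W1_deriv W4 x, of \<phi>max] x W3 by simp
    finally have "w x * (\<kappa> \<bullet> X) \<le> - (\<psi> x * (\<phi>max - x)) * (\<kappa> \<bullet> X)"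
      using k0 by (intro mult_right_mono) auto
    then show ?thesis
      using W2 x k0 by (simp add: tot M1_tilde_def x_def[symmetric] mult_ac)
  qed
  \<comment> \<open>Neighbouring states are read modulo \<open>M\<close> for either boundary
    condition, so both lie in the phase space for every integer \<open>k\<close>.\<close>
  have mod_cell: "k mod int M \<in> {0..<int M}" for k
    using grid(2) by simp
  \<comment> \<open>In one time step a rightward flux takes at most half of a species from the left
    cell, and a leftward flux at most half from the right cell. For the vacancy, whose flux is minus
    the total flux, the directions are reversed in the last two inequalities.\<close>
  have flux: "r * ?F k $ i \<le> left_state M (\<Phi> n) k $ i / 2"
    "- (right_state M (\<Phi> n) k $ i / 2) \<le> r * ?F k $ i"
    "- ((\<phi>max - total_conc (left_state M (\<Phi> n) k)) / 2) \<le> r * total_conc (?F k)"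
    "r * total_conc (?F k) \<le> (\<phi>max - total_conc (right_state M (\<Phi> n) k)) / 2" for k i
  proof -
    define X Y where "X = left_state M (\<Phi> n) k" and "Y = right_state M (\<Phi> n) k"
    have XY: "X \<in> phase_space \<phi>max" "Y \<in> phase_space \<phi>max"
      using inv mod_cell by (auto simp: X_def Y_def left_state_def right_state_def)
    have XY_nonneg: "0 \<le> X $ i" "0 \<le> Y $ i" "0 \<le> \<phi>max - total_conc X" "0 \<le> \<phi>max - total_conc Y"
      using phase_spaceD[OF XY(1)] phase_spaceD[OF XY(2)] by auto
    have "r * ?F k $ i \<le> X $ i / 2 \<and> - (Y $ i / 2) \<le> r * ?F k $ i \<and>
      - ((\<phi>max - total_conc X) / 2) \<le> r * total_conc (?F k) \<and>
      r * total_conc (?F k) \<le> (\<phi>max - total_conc Y) / 2"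
    proof (cases "k \<in> active_interfaces bc M")
      \<comment> \<open>The flux is zero, as at the ends of a zero-flux domain, and the bounds
        reduce to nonnegativity of species and vacancy.\<close>
      case False
      then show ?thesis
        using XY_nonneg by (simp add: numerical_flux_def total_conc_def)
    next
      case True
      define sL sR where "sL = min (speed_L ?M1 X Y) 0" and "sR = max (speed_R M2 X Y) 0"
      have Fk: "?F k = HLL_flux (flux vel) ?M1 M2 X Y"
        using True by (simp add: numerical_flux_def X_def Y_def)
      note F = HLL_flux_bounds[where ?K1.0 = "- (B * (norm \<kappa> * \<phi>max))" and ?K2.0 = K2 and vel = vel
          and ?M1.0 = ?M1 and ?M2.0 = M2, OF XY vel vacancy M1 M2]
      let ?\<alpha> = "max_speed bc M ?M1 M2 (\<Phi> n)"
      have "- sL \<le> ?\<alpha>" "sR \<le> ?\<alpha>"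
        using max_speed_ge[OF True, where ?M1.0 = ?M1 and ?M2.0 = M2 and u = "\<Phi> n"]
        by (auto simp: sL_def sR_def X_def Y_def)
      then have "r * - sL \<le> r * ?\<alpha>" "r * sR \<le> r * ?\<alpha>"
        using r by (simp_all only: mult_left_mono)
      moreover have "r * ?\<alpha> \<le> 1 / 2"
        using CFL n by (simp add: r_def mult.commute)
      ultimately have CFL_r: "r * - sL \<le> 1 / 2" "r * sR \<le> 1 / 2"
        by linarith+
      \<comment> \<open>This turns the constant 1/2 of the CFL condition into half of the content
        \<open>z\<close> of a cell.\<close>
      have scale: "r * (s * z) \<le> z / 2" if "r * s \<le> 1 / 2" "0 \<le> z" for s z
        using mult_right_mono[OF that] by (simp add: mult.assoc)
      have "r * ?F k $ i \<le> r * (sR * X $ i)" "r * - ?F k $ i \<le> r * (- sL * Y $ i)"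
        "r * - total_conc (?F k) \<le> r * (sR * (\<phi>max - total_conc X))"
        "r * total_conc (?F k) \<le> r * (- sL * (\<phi>max - total_conc Y))"
        using F(1,2)[of i] F(3,4) r unfolding Fk sL_def[symmetric] sR_def[symmetric]
        by (intro mult_left_mono; simp)+
      moreover note scale[OF CFL_r(2) XY_nonneg(1)] scale[OF CFL_r(1) XY_nonneg(2)]
        scale[OF CFL_r(2) XY_nonneg(3)] scale[OF CFL_r(1) XY_nonneg(4)]
      ultimately show ?thesis
        by (intro conjI; linarith)
    qed
    then show "r * ?F k $ i \<le> left_state M (\<Phi> n) k $ i / 2"
      "- (right_state M (\<Phi> n) k $ i / 2) \<le> r * ?F k $ i"
      "- ((\<phi>max - total_conc (left_state M (\<Phi> n) k)) / 2) \<le> r * total_conc (?F k)"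
      "r * total_conc (?F k) \<le> (\<phi>max - total_conc (right_state M (\<Phi> n) k)) / 2"
      unfolding X_def Y_def by auto
  qed
  \<comment> \<open>Cell \<open>j\<close> lies to the left of interface \<open>j\<close> and to the
    right of interface \<open>j - 1\<close>; the latter is the domain end -1 when \<open>j\<close>
    is 0.\<close>
  have cell: "left_state M (\<Phi> n) j = \<Phi> n j" "right_state M (\<Phi> n) (j - 1) = \<Phi> n j"
    using j by (simp_all add: left_state_def right_state_def)
  have step: "\<Phi> (Suc n) j = \<Phi> n j - r *\<^sub>R (?F j - ?F (j - 1))"
    using scheme n j by (simp add: r_def)
  \<comment> \<open>The two interfaces of the cell each remove at most half of the species; the same
    count for the vacancy gives the upper bound on the total.\<close>
  have "0 \<le> \<Phi> (Suc n) j $ i" for i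
    using flux(1)[of j i] flux(2)[of "j - 1" i] by (simp add: step cell right_diff_distrib)
  moreover have "total_conc (\<Phi> (Suc n) j) \<le> \<phi>max"
    using flux(3)[of j] flux(4)[of "j - 1"]
    unfolding step cell total_conc_diff total_conc_scaleR right_diff_distrib by argo
  ultimately show "\<Phi> (Suc n) j \<in> phase_space \<phi>max"
    by (simp add: phase_space_def)
qed

end
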